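(* Let $d\ge2$. For every positive integer $h_1$ there exists a $d$-dimensional integral simplicial convex polytope $\mathcal P\subset\mathbb R^d$ each of whose facets has normalized volume $1$ and such that the $h$-vector of the boundary complex of $\mathcal P$ equals $(1,h_1,h_1,\ldots,h_1,1)\in\mathbb Z^{d+1}$.
   Context: An integral convex polytope is one whose vertices have integer coordinates. For an integral convex polytope $\mathcal Q$ of dimension $e$ in $\mathbb R^N$, its $\delta$-vector $(\delta_0,\ldots,\delta_e)$ is defined by $(1-\lambda)^{e+1}\bigl[1+\sum_{n\ge1}|n\mathcal Q\cap\mathbb Z^N|\lambda^n\bigr]=\sum_{i=0}^e\delta_i\lambda^i$, and its normalized volume is $\sum_i\delta_i$. For a simplicial $d$-polytope with boundary complex having $f_{i}$ faces of dimension $i$ ($f_{-1}=1$), the $h$-vector $(h_0,\ldots,h_d)$ is defined by $\sum_{i=0}^d h_i x^{d-i}=\sum_{i=0}^{d} f_{i-1}(x-1)^{d-i}$. *)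

theory Defs
  imports "HOL-Analysis.Analysis" "HOL-Computational_Algebra.Computational_Algebra"
begin

definition lattice_points :: "(real ^ 'n) set" where
  "lattice_points = {x. \<forall>i. x $ i \<in> \<int>}"

definition integral_polytope :: "(real ^ 'n) set \<Rightarrow> bool" where
  "integral_polytope Q \<longleftrightarrow> polytope Q \<and> {v. v extreme_point_of Q} \<subseteq> lattice_points"

definition ehrhart_series :: "(real ^ 'n) set \<Rightarrow> int fps" where
  "ehrhart_series Q =
     Abs_fps (\<lambda>n. if n = 0 then 1 else int (card ((*\<^sub>R) (real n) ` Q \<inter> lattice_points)))"

text \<open>The $\delta$-vector $(\delta_0,\ldots,\delta_e)$ is a list of length $e+1$, where
  $e$ is the dimension of the polytope.  The defining identity determines the list uniquely.\<close>

definition is_delta_vector :: "(real ^ 'n) set \<Rightarrow> int list \<Rightarrow> bool" where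
  "is_delta_vector Q \<delta> \<longleftrightarrow>
     (let e = nat (aff_dim Q) in
        length \<delta> = e + 1 \<and>
        (1 - fps_X) ^ (e + 1) * ehrhart_series Q = (\<Sum>i\<le>e. fps_const (\<delta> ! i) * fps_X ^ i))"

definition has_normalized_volume :: "(real ^ 'n) set \<Rightarrow> int \<Rightarrow> bool" where
  "has_normalized_volume Q v \<longleftrightarrow> (\<exists>\<delta>. is_delta_vector Q \<delta> \<and> v = sum_list \<delta>)"

definition simplicial_polytope :: "'a::euclidean_space set \<Rightarrow> bool" where
  "simplicial_polytope P \<longleftrightarrow> polytope P \<and> (\<forall>F. F facet_of P \<longrightarrow> (\<exists>k. k simplex F))"

definition boundary_complex :: "'a::euclidean_space set \<Rightarrow> 'a set set" where
  "boundary_complex P = {F. F face_of P \<and> F \<noteq> P}"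

text \<open>The empty set is a face, and its affine dimension is $-1$, so that
  \<open>num_faces (boundary_complex P) (-1) = 1\<close> for nonempty \<open>P\<close>.\<close>

definition num_faces :: "'a::euclidean_space set set \<Rightarrow> int \<Rightarrow> nat" where
  "num_faces \<K> k = card {F \<in> \<K>. aff_dim F = k}"

text \<open>The $h$-vector $(h_0,\ldots,h_d)$ of the boundary complex of a $d$-polytope, as a list of
  length $d+1$; the polynomial \<open>[:-1, 1:]\<close> is $x-1$.\<close>

definition is_h_vector :: "'a::euclidean_space set \<Rightarrow> int list \<Rightarrow> bool" where
  "is_h_vector P h \<longleftrightarrow>
     (let d = nat (aff_dim P) in
        length h = d + 1 \<and>
        (\<Sum>i\<le>d. monom (h ! i) (d - i)) =
        (\<Sum>i\<le>d. smult (int (num_faces (boundary_complex P) (int i - 1))) ([:-1, 1:] ^ (d - i))))"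

end

theory Submission
  imports Defs
begin

text \<open>Stacking a vertex onto a facet adds $(0,1,\ldots,1,0)$ to the $h$-vector, so we stack
  $h_1 - 1$ times onto a simplex, always over a facet containing a fixed $(d-2)$-simplex $R$.  With
  $N = d - 1$, $m = h_1$ and $R = \mathrm{conv}(0, e_1, \ldots, e_{d-2})$, the other vertices are
  $p_i = (-i, \ldots, -i, 1 + Ni, i^2)$ for $0 \le i \le m$.  An affine functional restricts to
  this curve as a quadratic polynomial $A + (NA - C)i + q i^2$, where $C$ is the sum of its values
  at the vertices of $R$; if it is nonnegative on all vertices and $C > 0$, then its zeros
  on the curve lie among two consecutive $p_i$.  Hence the facets are spanned by $R \cup \{p_0\}$,
  $R \cup \{p_m\}$ and the sets $(R \setminus b) \cup \{p_i, p_{i+1}\}$ with $b$ a vertex of $R$.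
  All of these admit dual integral functionals, so they are unimodular, although the stacked
  $d$-simplices themselves are not.\<close>

section \<open>Unimodular simplices\<close>

lemma lattice_points_inner: "a \<in> lattice_points \<Longrightarrow> x \<in> lattice_points \<Longrightarrow> a \<bullet> x \<in> \<int>"
  unfolding lattice_points_def inner_vec_def by (auto intro: Ints_sum)

lemma lattice_points_sum:
  assumes "\<And>i. i \<in> I \<Longrightarrow> f i \<in> lattice_points"
  shows "(\<Sum>i\<in>I. real (c i) *\<^sub>R f i) \<in> lattice_points"
  using assms unfolding lattice_points_def by (auto intro!: Ints_sum Ints_mult)

text \<open>The functionals witness that \<open>S\<close> lifted to height 1 is part of a basis of the lattice:
  they read off barycentric coordinates and are integral.\<close>

definition unimodular :: "(real ^ 'n) set \<Rightarrow> bool" where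
  "unimodular S \<longleftrightarrow> finite S \<and> S \<subseteq> lattice_points \<and>
     (\<forall>s\<in>S. \<exists>a \<beta>. a \<in> lattice_points \<and> \<beta> \<in> \<int> \<and>
        (\<forall>t\<in>S. a \<bullet> t + \<beta> = (if t = s then 1 else 0)))"

text \<open>Linearity carries the dual functional from the points of \<open>S\<close> to all linear
  combinations. The constant is multiplied by the total weight, so weights of any sum are allowed:
  sum 0 gives affine independence, sum \<open>n\<close> gives the points of the \<open>n\<close>-th
  dilate.\<close>

lemma unimodular_coordinate:
  fixes S :: "(real ^ 'n) set"
  assumes "unimodular S" "s \<in> S"
  obtains a \<beta> where "a \<in> lattice_points" "\<beta> \<in> \<int>"
    "\<forall>w :: real ^ 'n \<Rightarrow> real. a \<bullet> (\<Sum>t\<in>S. w t *\<^sub>R t) + \<beta> * (\<Sum>t\<in>S. w t) = w s"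
proof -
  obtain a \<beta> where ab: "a \<in> lattice_points" "\<beta> \<in> \<int>"
      "\<forall>t\<in>S. a \<bullet> t + \<beta> = (if t = s then 1 else 0)" and fin: "finite S"
    using assms unfolding unimodular_def by blast
  have "a \<bullet> (\<Sum>t\<in>S. w t *\<^sub>R t) + \<beta> * (\<Sum>t\<in>S. w t) = w s" for w :: "real ^ 'n \<Rightarrow> real"
  proof -
    have "a \<bullet> (\<Sum>t\<in>S. w t *\<^sub>R t) + \<beta> * (\<Sum>t\<in>S. w t) = (\<Sum>t\<in>S. w t * (a \<bullet> t + \<beta>))"
      by (simp add: inner_sum_right sum_distrib_left sum.distrib [symmetric] algebra_simps)
    also have "\<dots> = (\<Sum>t\<in>S. if t = s then w t else 0)"
      using ab(3) by (intro sum.cong) auto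
    also have "\<dots> = w s"
      using fin \<open>s \<in> S\<close> by simp
    finally show ?thesis .
  qed
  with ab that show ?thesis by blast
qed

lemma unimodular_imp_affine_independent:
  fixes S :: "(real ^ 'n) set"
  assumes "unimodular S"
  shows "\<not> affine_dependent S"
proof
  have "finite S" using assms by (simp add: unimodular_def)
  moreover assume "affine_dependent S"
  ultimately obtain U v where U: "sum U S = 0" "v \<in> S" "U v \<noteq> 0" "(\<Sum>v\<in>S. U v *\<^sub>R v) = 0"
    by (auto simp: affine_dependent_explicit_finite)
  obtain a \<beta> where "a \<in> lattice_points" "\<beta> \<in> \<int>"
      and ab: "\<forall>w. a \<bullet> (\<Sum>t\<in>S. w t *\<^sub>R t) + \<beta> * (\<Sum>t\<in>S. w t) = w v"
    by (rule unimodular_coordinate[OF assms U(2)])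
  from ab[rule_format, of U] U show False by simp
qed

text \<open>The dual functionals are integral, so a point of the dilated simplex is a lattice point
  exactly when its coordinates scaled by \<open>n\<close> are natural numbers. These coordinate
  vectors are the lists of length \<open>card S\<close> with sum \<open>n\<close>.\<close>

lemma card_lattice_points_dilation_unimodular:
  fixes S :: "(real ^ 'n) set"
  assumes S: "unimodular S" and n: "n > 0"
  shows "card ((*\<^sub>R) (real n) ` (convex hull S) \<inter> lattice_points) = card (natpermute n (card S))"
proof -
  define k where "k = card S"
  have fin: "finite S" and SL: "S \<subseteq> lattice_points" using S by (auto simp: unimodular_def)
  obtain h where h: "bij_betw h {0..<k} S"
    using ex_bij_betw_nat_finite[OF fin] k_def by blast
  define \<Phi> where "\<Phi> = (\<lambda>l :: nat list. \<Sum>i<k. real (l ! i) *\<^sub>R h i)"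
  have reindex: "(\<Sum>i<k. g (h i)) = sum g S" for g :: "real ^ 'n \<Rightarrow> 'b::comm_monoid_add"
    using sum.reindex_bij_betw[OF h, of g] by (simp add: lessThan_atLeast0)
  have hS: "h i \<in> S" if "i < k" for i
    using h that by (auto simp: bij_betw_def)
  \<comment> \<open>The inverse of the enumeration turns \<open>\<Phi>\<close> into a sum over
    \<open>S\<close>, the shape that \<open>unimodular_coordinate\<close> speaks about.\<close>
  define idx where "idx = inv_into {0..<k} h"
  have idx: "idx (h i) = i" if "i < k" for i
    using h that unfolding idx_def bij_betw_def by (simp add: inv_into_f_f)
  have \<Phi>S: "\<Phi> l = (\<Sum>t\<in>S. real (l ! idx t) *\<^sub>R t)" for l
    unfolding reindex[symmetric] \<Phi>_def by (intro sum.cong) (auto simp: idx)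
  have sumS: "(\<Sum>t\<in>S. real (l ! idx t)) = n" if "l \<in> natpermute n k" for l
  proof -
    have "(\<Sum>t\<in>S. real (l ! idx t)) = (\<Sum>i<k. real (l ! i))"
      unfolding reindex[symmetric] by (intro sum.cong) (auto simp: idx)
    also have "\<dots> = real (sum_list l)"
      using that by (simp add: natpermute_def sum_list_sum_nth lessThan_atLeast0)
    finally show ?thesis using that by (simp add: natpermute_def)
  qed
  have inj: "inj_on \<Phi> (natpermute n k)"
  proof (rule inj_onI)
    fix l l' assume l: "l \<in> natpermute n k" "l' \<in> natpermute n k" and eq: "\<Phi> l = \<Phi> l'"
    have "l ! i = l' ! i" if i: "i < k" for i
    proof -
      obtain a \<beta> where ab: "a \<in> lattice_points" "\<beta> \<in> \<int>"
          "\<forall>w. a \<bullet> (\<Sum>t\<in>S. w t *\<^sub>R t) + \<beta> * (\<Sum>t\<in>S. w t) = w (h i)"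
        by (rule unimodular_coordinate[OF S hS[OF i]])
      have "real (l ! idx (h i)) = real (l' ! idx (h i))"
        using ab(3)[rule_format, of "\<lambda>t. real (l ! idx t)"] ab(3)[rule_format, of "\<lambda>t. real (l' ! idx t)"] eq
        by (simp add: \<Phi>S sumS[OF l(1)] sumS[OF l(2)])
      with i show ?thesis by (simp add: idx)
    qed
    with l show "l = l'"
      by (intro nth_equalityI) (auto simp: natpermute_def)
  qed
  have "\<Phi> ` natpermute n k = (*\<^sub>R) (real n) ` (convex hull S) \<inter> lattice_points"
  proof (intro equalityI subsetI)
    fix x assume "x \<in> \<Phi> ` natpermute n k"
    then obtain l where l: "l \<in> natpermute n k" and x: "x = \<Phi> l" by blast
    have "x \<in> lattice_points"
      unfolding x \<Phi>_def using hS SL by (intro lattice_points_sum) auto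
    moreover have "x = real n *\<^sub>R (\<Sum>t\<in>S. (real (l ! idx t) / n) *\<^sub>R t)"
      using n by (simp add: x \<Phi>S scaleR_sum_right)
    moreover have "(\<Sum>t\<in>S. (real (l ! idx t) / n) *\<^sub>R t) \<in> convex hull S"
      using sumS[OF l] n
      by (intro convex_sum convex_convex_hull fin) (auto simp: sum_divide_distrib[symmetric] hull_inc)
    ultimately show "x \<in> (*\<^sub>R) (real n) ` (convex hull S) \<inter> lattice_points" by blast
  next
    fix x assume "x \<in> (*\<^sub>R) (real n) ` (convex hull S) \<inter> lattice_points"
    then obtain w where w: "\<forall>t\<in>S. 0 \<le> w t" "sum w S = 1"
        and xw: "x = real n *\<^sub>R (\<Sum>t\<in>S. w t *\<^sub>R t)" and xL: "x \<in> lattice_points"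
      by (auto simp: convex_hull_finite[OF fin])
    have x: "x = (\<Sum>t\<in>S. (n * w t) *\<^sub>R t)" by (simp add: xw scaleR_sum_right)
    \<comment> \<open>The only use of integrality of the functional: it evaluates at the lattice
      point \<open>x\<close> to the scaled coordinate.\<close>
    have nw: "n * w t \<in> \<int>" if t: "t \<in> S" for t
    proof -
      obtain a \<beta> where ab: "a \<in> lattice_points" "\<beta> \<in> \<int>"
          "\<forall>w. a \<bullet> (\<Sum>t\<in>S. w t *\<^sub>R t) + \<beta> * (\<Sum>t\<in>S. w t) = w t"
        by (rule unimodular_coordinate[OF S t])
      have "a \<bullet> x + \<beta> * real n = n * w t"
        using ab(3)[rule_format, of "\<lambda>t. n * w t"] w(2) by (simp add: x sum_distrib_left[symmetric])
      moreover have "a \<bullet> x + \<beta> * real n \<in> \<int>"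
        using ab xL by (intro Ints_add Ints_mult lattice_points_inner) auto
      ultimately show ?thesis by simp
    qed
    \<comment> \<open>The scaled coordinates are already natural numbers; \<open>nat\<close> and the
      floor only change the type.\<close>
    define l where "l = map (\<lambda>i. nat \<lfloor>n * w (h i)\<rfloor>) [0..<k]"
    have li: "real (l ! i) = n * w (h i)" if "i < k" for i
      using that nw[OF hS[OF that]] w(1) hS[OF that] by (auto simp: l_def elim!: Ints_cases)
    have "real (sum_list l) = (\<Sum>i<k. real (l ! i))"
      by (simp add: sum_list_sum_nth l_def lessThan_atLeast0)
    also have "\<dots> = (\<Sum>i<k. n * w (h i))" by (intro sum.cong) (auto simp: li)
    also have "\<dots> = n" using reindex[of "\<lambda>t. n * w t"] w(2) by (simp add: sum_distrib_left[symmetric])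
    finally have "l \<in> natpermute n k" by (simp add: natpermute_def l_def)
    moreover have "\<Phi> l = x"
      unfolding \<Phi>_def x reindex[symmetric] by (intro sum.cong) (auto simp: li)
    ultimately show "x \<in> \<Phi> ` natpermute n k" by blast
  qed
  with card_image[OF inj] show ?thesis by (simp add: k_def)
qed

text \<open>In the \<open>k\<close>-fold product of the geometric series, each list in
  \<open>natpermute n k\<close> contributes a product of ones to the coefficient of index
  \<open>n\<close>.\<close>

lemma card_natpermute_fps:
  assumes "k > 0"
  shows "Abs_fps (\<lambda>_. 1 :: int) ^ k = Abs_fps (\<lambda>n. int (card (natpermute n k)))"
  using assms by (intro fps_ext) (simp add: fps_power_nth)

lemma one_minus_fps_X_mult_geometric: "(1 - fps_X) * Abs_fps (\<lambda>_. 1 :: int) = 1"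
  by (intro fps_ext) (auto simp: left_diff_distrib)

text \<open>The Ehrhart series is the \<open>k\<close>-th power of the geometric series, and
  \<open>k\<close> is the dimension plus one, so the prescribed power of \<open>1 - fps_X\<close>
  cancels it completely. The delta vector is therefore \<open>(1, 0, ..., 0)\<close>.\<close>

lemma unimodular_normalized_volume:
  fixes S :: "(real ^ 'n) set"
  assumes S: "unimodular S" and ne: "S \<noteq> {}"
  shows "has_normalized_volume (convex hull S) 1"
proof -
  define k where "k = card S"
  have k: "k > 0" using S ne by (auto simp: k_def unimodular_def card_gt_0_iff)
  have e: "nat (aff_dim (convex hull S)) + 1 = k"
    using aff_dim_affine_independent[OF unimodular_imp_affine_independent[OF S]] k
    by (simp add: aff_dim_convex_hull k_def nat_diff_distrib)
  \<comment> \<open>This settles the coefficient at 0, which \<open>ehrhart_series\<close> sets to 1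
    separately; the dilation count covers only \<open>n > 0\<close>.\<close>
  have "natpermute 0 k = {replicate k 0}"
    using k by (auto simp: natpermute_def intro!: replicate_eqI)
  then have "ehrhart_series (convex hull S) = Abs_fps (\<lambda>_. 1) ^ k"
    unfolding ehrhart_series_def card_natpermute_fps[OF k]
    by (intro arg_cong[where f = Abs_fps] ext)
       (use card_lattice_points_dilation_unimodular[OF S] in \<open>simp add: k_def\<close>)
  then have series: "(1 - fps_X) ^ k * ehrhart_series (convex hull S) = 1"
    by (simp add: power_mult_distrib[symmetric] one_minus_fps_X_mult_geometric)
  define \<delta> where "\<delta> = (1 :: int) # replicate (k - 1) 0"
  have nth: "\<delta> ! i = (if i = 0 then 1 else 0)" if "i \<le> k - 1" for i
    using that by (cases i) (auto simp: \<delta>_def)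
  have "(\<Sum>i\<le>k - 1. fps_const (\<delta> ! i) * fps_X ^ i) = (\<Sum>i\<le>k - 1. if i = 0 then 1 else 0)"
    by (intro sum.cong) (auto simp: nth)
  also have "\<dots> = (1 :: int fps)" by simp
  finally have "is_delta_vector (convex hull S) \<delta>"
    unfolding is_delta_vector_def Let_def using e series k
    by (auto simp: \<delta>_def simp flip: e)
  moreover have "sum_list \<delta> = 1" by (simp add: \<delta>_def sum_list_replicate)
  ultimately show ?thesis unfolding has_normalized_volume_def by metis
qed

section \<open>Boundary complexes of simplicial polytopes\<close>

text \<open>A certificate for the whole boundary complex: \<open>supp\<close> makes every listed set
  span a face, independence makes all its subsets span faces too, and \<open>max\<close> leaves room
  for no others, because every proper face is cut out by a supporting hyperplane.\<close>

lemma boundary_complex_convex_hull: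
  fixes V :: "'a::euclidean_space set"
  assumes fin: "finite V"
    and indep: "\<And>F. F \<in> \<F> \<Longrightarrow> \<not> affine_dependent F"
    and proper: "\<And>F. F \<in> \<F> \<Longrightarrow> F \<noteq> V"
    and supp: "\<And>F. F \<in> \<F> \<Longrightarrow> \<exists>a c. (\<forall>v\<in>V. 0 \<le> a \<bullet> v + c) \<and> F = {v \<in> V. a \<bullet> v + c = 0}"
    and max: "\<And>a c. \<forall>v\<in>V. 0 \<le> a \<bullet> v + c \<Longrightarrow> {v \<in> V. a \<bullet> v + c = 0} \<noteq> V \<Longrightarrow>
                \<exists>F\<in>\<F>. {v \<in> V. a \<bullet> v + c = 0} \<subseteq> F"
  shows "boundary_complex (convex hull V) = (hull) convex ` {S. \<exists>F\<in>\<F>. S \<subseteq> F}"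
proof (intro equalityI subsetI)
  fix T assume "T \<in> boundary_complex (convex hull V)"
  then have T: "T face_of convex hull V" and ne: "T \<noteq> convex hull V"
    by (auto simp: boundary_complex_def)
  \<comment> \<open>Faces of polyhedra are exposed, which supplies a supporting functional even for
    lower-dimensional \<open>T\<close>.\<close>
  have "polyhedron (convex hull V)" using fin by (simp add: polyhedron_convex_hull)
  then have "T exposed_face_of convex hull V" using T exposed_face_of_polyhedron by blast
  then obtain a b where ab: "convex hull V \<subseteq> {x. a \<bullet> x \<le> b}" "T = convex hull V \<inter> {x. a \<bullet> x = b}"
    unfolding exposed_face_of_def by (elim conjE exE)
  obtain S where S: "S \<subseteq> V" "T = convex hull S"
    by (rule face_of_convex_hull_subset[OF finite_imp_compact[OF fin] T])
  \<comment> \<open>The sign is reversed because the exposed face comes with an upper bound, while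
    \<open>max\<close> expects a nonnegative functional.\<close>
  define Z where "Z = {v \<in> V. (- a) \<bullet> v + b = 0}"
  have SZ: "S \<subseteq> Z"
  proof
    fix v assume "v \<in> S"
    then have "v \<in> T" using S(2) by (simp add: hull_inc)
    then have "a \<bullet> v = b" using ab(2) by simp
    then show "v \<in> Z" using S(1) \<open>v \<in> S\<close> by (auto simp: Z_def)
  qed
  have "Z \<noteq> V"
  proof
    assume "Z = V"
    then have "V \<subseteq> {x. a \<bullet> x = b}" by (auto simp: Z_def)
    then have "convex hull V \<subseteq> {x. a \<bullet> x = b}" by (intro hull_minimal convex_hyperplane)
    then have "T = convex hull V" unfolding ab(2) by (rule Int_absorb2)
    with ne show False ..
  qed
  moreover have "\<forall>v\<in>V. 0 \<le> (- a) \<bullet> v + b"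
    using ab(1) hull_subset[of V convex] by auto
  ultimately obtain F where "F \<in> \<F>" "Z \<subseteq> F"
    using max[of "- a" b] unfolding Z_def by blast
  with SZ S(2) show "T \<in> (hull) convex ` {S. \<exists>F\<in>\<F>. S \<subseteq> F}" by blast
next
  fix T assume "T \<in> (hull) convex ` {S. \<exists>F\<in>\<F>. S \<subseteq> F}"
  then obtain S F where T: "T = convex hull S" and F: "F \<in> \<F>" and SF: "S \<subseteq> F" by blast
  obtain a c where ac: "\<forall>v\<in>V. 0 \<le> a \<bullet> v + c" "F = {v \<in> V. a \<bullet> v + c = 0}"
    using supp[OF F] by blast
  have "convex hull V \<subseteq> {x. a \<bullet> x \<ge> - c}"
    using ac(1) by (intro hull_minimal convex_halfspace_ge) force
  then have face: "(convex hull V \<inter> {x. a \<bullet> x = - c}) face_of convex hull V"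
    by (intro face_of_Int_supporting_hyperplane_ge) auto
  have hyp: "convex hull F \<subseteq> {x. a \<bullet> x = - c}"
    using ac(2) by (intro hull_minimal convex_hyperplane) force
  obtain S' where S': "S' \<subseteq> V" "convex hull V \<inter> {x. a \<bullet> x = - c} = convex hull S'"
    by (rule face_of_convex_hull_subset[OF finite_imp_compact[OF fin] face])
  \<comment> \<open>The face cut out by the hyperplane is spanned by points of \<open>V\<close>
    lying on it, and these belong to \<open>F\<close>; hence the face is the hull of
    \<open>F\<close>.\<close>
  have "S' \<subseteq> F"
  proof
    fix v assume "v \<in> S'"
    then have "v \<in> convex hull V \<inter> {x. a \<bullet> x = - c}" unfolding S'(2) by (rule hull_inc)
    with S'(1) \<open>v \<in> S'\<close> show "v \<in> F" unfolding ac(2) by auto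
  qed
  then have "convex hull V \<inter> {x. a \<bullet> x = - c} \<subseteq> convex hull F"
    unfolding S'(2) by (rule hull_mono)
  moreover have "convex hull F \<subseteq> convex hull V" using ac(2) by (intro hull_mono) auto
  ultimately have "convex hull F = convex hull V \<inter> {x. a \<bullet> x = - c}" using hyp by blast
  with face have "convex hull F face_of convex hull V" by simp
  moreover have "T face_of convex hull F"
    using SF T face_of_convex_hull_affine_independent[OF indep[OF F]] by blast
  ultimately have "T face_of convex hull V" using face_of_trans by blast
  moreover have "T \<noteq> convex hull V"
  proof
    assume "T = convex hull V"
    then have "V \<subseteq> convex hull F"
      using T hull_mono[OF SF, of convex] hull_subset[of V convex] by blast
    then have "\<forall>v\<in>V. a \<bullet> v + c = 0" using hyp by force
    then have "V \<subseteq> F" unfolding ac(2) by blast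
    moreover have "F \<subseteq> V" unfolding ac(2) by (rule Collect_restrict)
    ultimately show False using proper[OF F] by simp
  qed
  ultimately show "T \<in> boundary_complex (convex hull V)" by (simp add: boundary_complex_def)
qed

text \<open>The set is recovered from its hull as the set of extreme points. Counting faces thus
  becomes counting vertex sets.\<close>

lemma inj_on_convex_hull_affine_independent:
  fixes \<Delta> :: "'a::euclidean_space set set"
  assumes "\<And>S. S \<in> \<Delta> \<Longrightarrow> \<not> affine_dependent S"
  shows "inj_on ((hull) convex) \<Delta>"
proof (rule inj_onI)
  fix S T assume "S \<in> \<Delta>" "T \<in> \<Delta>" "convex hull S = convex hull T"
  then show "S = T"
    using extreme_point_of_convex_hull_affine_independent[OF assms]
    by (metis subsetI subset_antisym)
qed

text \<open>An independent set with \<open>i\<close> elements spans a face of dimension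
  \<open>i - 1\<close>, the empty set included, so grouping the sets by cardinality yields the face
  numbers. With \<open>y\<close> equal to \<open>x - 1\<close> the left side is the right side of
  the definition of the h-vector.\<close>

lemma sum_num_faces:
  fixes \<Delta> :: "'a::euclidean_space set set"
  assumes fin: "finite \<Delta>"
    and indep: "\<And>S. S \<in> \<Delta> \<Longrightarrow> \<not> affine_dependent S"
    and card: "\<And>S. S \<in> \<Delta> \<Longrightarrow> card S \<le> d"
  shows "(\<Sum>i\<le>d. smult (int (num_faces ((hull) convex ` \<Delta>) (int i - 1))) (y ^ (d - i))) =
    (\<Sum>S\<in>\<Delta>. y ^ (d - card S))"
proof -
  have nf: "num_faces ((hull) convex ` \<Delta>) (int i - 1) = card {S \<in> \<Delta>. card S = i}" for i
  proof -
    have "{F \<in> (hull) convex ` \<Delta>. aff_dim F = int i - 1} = (hull) convex ` {S \<in> \<Delta>. card S = i}"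
    proof -
      have "aff_dim (convex hull S) = int i - 1 \<longleftrightarrow> card S = i" if "S \<in> \<Delta>" for S
        using aff_dim_affine_independent[OF indep[OF that]] by (auto simp: aff_dim_convex_hull)
      then show ?thesis by blast
    qed
    moreover have "inj_on ((hull) convex) {S \<in> \<Delta>. card S = i}"
      using inj_on_convex_hull_affine_independent[of \<Delta>] indep by (auto elim: inj_on_subset)
    ultimately show ?thesis by (simp add: num_faces_def card_image)
  qed
  have "(\<Sum>i\<le>d. smult (int (num_faces ((hull) convex ` \<Delta>) (int i - 1))) (y ^ (d - i))) =
      (\<Sum>i\<le>d. \<Sum>S\<in>{S \<in> \<Delta>. card S = i}. y ^ (d - card S))"
  proof (rule sum.cong)
    fix i
    have "(\<Sum>S\<in>{S \<in> \<Delta>. card S = i}. y ^ (d - card S)) = (\<Sum>S\<in>{S \<in> \<Delta>. card S = i}. y ^ (d - i))"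
      by (rule sum.cong) auto
    then show "smult (int (num_faces ((hull) convex ` \<Delta>) (int i - 1))) (y ^ (d - i)) =
        (\<Sum>S\<in>{S \<in> \<Delta>. card S = i}. y ^ (d - card S))"
      by (simp add: nf of_nat_poly)
  qed simp
  also have "\<dots> = (\<Sum>S\<in>\<Delta>. y ^ (d - card S))"
    using card by (intro sum.group fin) auto
  finally show ?thesis .
qed

section \<open>Face numbers of stacked polytopes\<close>

text \<open>Expand the product of the factors \<open>1 + y\<close> over \<open>A\<close>;
  \<open>B\<close> is the set of factors from which 1 is chosen.\<close>

lemma prod_sum_faces:
  "finite A \<Longrightarrow> (\<Sum>B\<in>Pow A. (y :: 'a::comm_ring_1) ^ (card A - card B)) = (1 + y) ^ card A"
  using prod_add[of A "\<lambda>_. 1" "\<lambda>_. y"]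
  by (simp add: card_Diff_subset finite_subset)

text \<open>The facets of the join of the boundary of the simplex \<open>R\<close> with the path
  \<open>p 0, ..., p m\<close>, closed up by the cones over \<open>R\<close> from the two ends of
  the path.\<close>

definition stacked_facets :: "'a set \<Rightarrow> (nat \<Rightarrow> 'a) \<Rightarrow> nat \<Rightarrow> 'a set set" where
  "stacked_facets R p m = {insert (p 0) R, insert (p m) R} \<union>
     (\<Union>b\<in>R. (\<lambda>i. (R - {b}) \<union> {p i, p (Suc i)}) ` {..<m})"

text \<open>The exponent is one more than in the \<open>h\<close>-polynomial, so that no division by \<open>y\<close> is needed.\<close>

lemma stacked_faces_sum:
  fixes y :: "'b::comm_ring_1"
  assumes R: "finite R" "R \<noteq> {}" and inj: "inj_on p {..m}" and disj: "p ` {..m} \<inter> R = {}"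
    and m: "m > 0"
  shows "(\<Sum>S | \<exists>F\<in>stacked_facets R p m. S \<subseteq> F. y ^ (card R + 2 - card S)) =
    ((1 + y) ^ card R - 1) * ((1 + y) * (y + of_nat m)) + y ^ 2 + 2 * y"
proof -
  \<comment> \<open>\<open>\<Q>\<close> consists of the faces of the path. A face of the complex
    splits uniquely into a part \<open>B\<close> inside \<open>R\<close> and a part \<open>Q\<close>
    on the path: \<open>X\<close> collects the faces with \<open>B\<close> proper in
    \<open>R\<close>, where \<open>Q\<close> is arbitrary, and \<open>Y\<close> those containing
    \<open>R\<close>, where only the ends of the path can be added.\<close>
  define \<Q> where "\<Q> = insert {} ((\<lambda>i. {p i}) ` {..m} \<union> (\<lambda>i. {p i, p (Suc i)}) ` {..<m})"
  define X where "X = (Pow R - {R}) \<times> \<Q>"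
  define Y where "Y = {R} \<times> {{}, {p 0}, {p m}}"
  define f where "f = (\<lambda>(B, Q). B \<union> Q :: 'a set)"
  have p_eq: "p i = p j \<longleftrightarrow> i = j" if "i \<le> m" "j \<le> m" for i j
    using inj that by (auto simp: inj_on_def)
  have p_notin: "p i \<notin> R" if "i \<le> m" for i using disj that by auto
  have \<Q>sub: "Q \<subseteq> p ` {..m}" if "Q \<in> \<Q>" for Q using that by (auto simp: \<Q>_def)
  have XY: "B \<subseteq> R \<and> Q \<subseteq> p ` {..m}" if "(B, Q) \<in> X \<union> Y" for B Q
    using that \<Q>sub by (auto simp: X_def Y_def)
  have inj_f: "inj_on f (X \<union> Y)"
  proof (rule inj_onI)
    fix z z' assume z: "z \<in> X \<union> Y" "z' \<in> X \<union> Y" "f z = f z'"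
    obtain B Q B' Q' where e: "z = (B, Q)" "z' = (B', Q')" by fastforce
    have "B \<subseteq> R" "Q \<subseteq> p ` {..m}" "B' \<subseteq> R" "Q' \<subseteq> p ` {..m}" "B \<union> Q = B' \<union> Q'"
      using XY z unfolding e f_def by auto
    moreover have "B = (B \<union> Q) \<inter> R" "Q = (B \<union> Q) - R" "B' = (B' \<union> Q') \<inter> R" "Q' = (B' \<union> Q') - R"
      using disj calculation(1-4) by auto
    ultimately show "z = z'" unfolding e by metis
  qed
  have \<Delta>: "{S. \<exists>F\<in>stacked_facets R p m. S \<subseteq> F} = f ` (X \<union> Y)"
  proof (intro equalityI subsetI)
    fix S assume "S \<in> {S. \<exists>F\<in>stacked_facets R p m. S \<subseteq> F}"
    then obtain F where F: "F \<in> stacked_facets R p m" "S \<subseteq> F" by blast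
    define B where "B = S \<inter> R"
    define Q where "Q = S - R"
    have S: "S = f (B, Q)" by (auto simp: f_def B_def Q_def)
    from F(1) consider j where "F = insert (p j) R" "j = 0 \<or> j = m"
      | b i where "b \<in> R" "i < m" "F = (R - {b}) \<union> {p i, p (Suc i)}"
      unfolding stacked_facets_def by blast
    then have "(B, Q) \<in> X \<union> Y"
    proof cases
      case 1
      then have "Q \<subseteq> {p j}" using F(2) by (auto simp: Q_def)
      then have "Q = {} \<or> Q = {p j}" by blast
      then show ?thesis using 1(2) by (auto simp: X_def Y_def \<Q>_def B_def)
    next
      case 2
      then have "Q \<subseteq> {p i, p (Suc i)}" using F(2) by (auto simp: Q_def)
      then have "Q = {} \<or> Q = {p i} \<or> Q = {p (Suc i)} \<or> Q = {p i, p (Suc i)}" by blast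
      then have "Q \<in> \<Q>" using 2(2) by (auto simp: \<Q>_def)
      moreover have "b \<notin> B" using 2 p_notin[of i] p_notin[of "Suc i"] F(2) by (auto simp: B_def)
      ultimately show ?thesis using 2(1) by (auto simp: X_def B_def)
    qed
    with S show "S \<in> f ` (X \<union> Y)" by blast
  next
    fix S assume "S \<in> f ` (X \<union> Y)"
    then obtain B Q where BQ: "(B, Q) \<in> X \<union> Y" "S = B \<union> Q" by (auto simp: f_def)
    show "S \<in> {S. \<exists>F\<in>stacked_facets R p m. S \<subseteq> F}"
    proof (cases "(B, Q) \<in> Y")
      case True
      then have "S \<subseteq> insert (p 0) R \<or> S \<subseteq> insert (p m) R" using BQ by (auto simp: Y_def)
      then show ?thesis by (auto simp: stacked_facets_def)
    next
      case False
      then obtain b where b: "b \<in> R" "B \<subseteq> R - {b}" and Q: "Q \<in> \<Q>" using BQ by (auto simp: X_def)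
      have "\<exists>i<m. Q \<subseteq> {p i, p (Suc i)}"
      proof -
        have "\<exists>i<m. {p j} \<subseteq> {p i, p (Suc i)}" if "j \<le> m" for j
          using that m by (cases j) (auto intro: Suc_le_lessD)
        with Q m show ?thesis by (auto simp: \<Q>_def)
      qed
      then obtain i where "i < m" "Q \<subseteq> {p i, p (Suc i)}" by blast
      then show ?thesis using b BQ(2) unfolding stacked_facets_def by blast
    qed
  qed
  have finQ: "finite \<Q>" by (simp add: \<Q>_def)
  have finXY: "finite X" "finite Y" using R finQ by (auto simp: X_def Y_def)
  have cardQ: "card Q \<le> 2" if "Q \<in> \<Q>" for Q
    using that by (auto simp: \<Q>_def card_insert_if)
  have finQ': "finite Q" if "Q \<in> \<Q>" for Q
    using that by (auto simp: \<Q>_def)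
  have card_f: "card (f (B, Q)) = card B + card Q" if "(B, Q) \<in> X \<union> Y" for B Q
  proof -
    have "finite B" "finite Q" "B \<inter> Q = {}"
      using XY[OF that] R disj by (auto intro: finite_subset)
    then show ?thesis by (simp add: f_def card_Un_disjoint)
  qed
  \<comment> \<open>One empty face, \<open>m + 1\<close> vertices and \<open>m\<close> edges give
    \<open>y^2 + (m + 1) y + m\<close>, which factors.\<close>
  have sumQ: "(\<Sum>Q\<in>\<Q>. y ^ (2 - card Q)) = (1 + y) * (y + of_nat m)"
  proof -
    have s1: "inj_on (\<lambda>i. {p i}) {..m}" by (auto simp: inj_on_def p_eq)
    have s2: "inj_on (\<lambda>i. {p i, p (Suc i)}) {..<m}"
      by (rule inj_onI) (auto simp: doubleton_eq_iff p_eq)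
    have s3: "(\<lambda>i. {p i}) ` {..m} \<inter> (\<lambda>i. {p i, p (Suc i)}) ` {..<m} = {}"
      by (auto simp: p_eq)
    have "(\<Sum>Q\<in>\<Q>. y ^ (2 - card Q)) = y ^ 2 + ((\<Sum>i\<le>m. y ^ (2 - card {p i})) +
        (\<Sum>i<m. y ^ (2 - card {p i, p (Suc i)})))"
      unfolding \<Q>_def
      by (subst sum.insert, simp, force, subst sum.union_disjoint, simp, simp, rule s3)
         (simp add: sum.reindex[OF s1] sum.reindex[OF s2])
    also have "(\<Sum>i<m. y ^ (2 - card {p i, p (Suc i)})) = (\<Sum>i<m. 1)"
      by (intro sum.cong) (auto simp: p_eq card_insert_if)
    also have "(\<Sum>i\<le>m. y ^ (2 - card {p i})) = (\<Sum>i\<le>m. y)"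
      by (intro sum.cong) auto
    finally show ?thesis by (simp add: algebra_simps power2_eq_square)
  qed
  have sumX: "(\<Sum>z\<in>X. y ^ (card R + 2 - card (f z))) = ((1 + y) ^ card R - 1) * ((1 + y) * (y + of_nat m))"
  proof -
    have "(\<Sum>z\<in>X. y ^ (card R + 2 - card (f z))) =
        (\<Sum>(B, Q)\<in>X. y ^ (card R - card B) * y ^ (2 - card Q))"
    proof (rule sum.cong)
      fix z assume "z \<in> X"
      then obtain B Q where z: "z = (B, Q)" "B \<subseteq> R" "Q \<in> \<Q>" by (auto simp: X_def)
      have "card (f z) = card B + card Q" using card_f \<open>z \<in> X\<close> z by simp
      moreover have "card B \<le> card R" using z R by (simp add: card_mono)
      ultimately have "card R + 2 - card (f z) = (card R - card B) + (2 - card Q)"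
        using cardQ[OF z(3)] by simp
      then show "y ^ (card R + 2 - card (f z)) =
          (case z of (B, Q) \<Rightarrow> y ^ (card R - card B) * y ^ (2 - card Q))"
        by (simp add: z(1) power_add)
    qed simp
    also have "\<dots> = (\<Sum>B\<in>Pow R - {R}. y ^ (card R - card B)) * (\<Sum>Q\<in>\<Q>. y ^ (2 - card Q))"
      unfolding X_def by (simp add: sum_product sum.cartesian_product)
    \<comment> \<open>Leaving out \<open>B = R\<close> removes the term \<open>y ^ 0\<close>, hence
      the subtracted 1.\<close>
    also have "(\<Sum>B\<in>Pow R - {R}. y ^ (card R - card B)) = (1 + y) ^ card R - 1"
      using R prod_sum_faces[of R y] by (simp add: sum_diff1)
    finally show ?thesis by (simp add: sumQ)
  qed
  have "p 0 \<noteq> p m" using p_eq[of 0 m] m by simp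
  then have "(\<Sum>z\<in>Y. y ^ (card R + 2 - card (f z))) = y ^ 2 + 2 * y"
  proof -
    have "(\<Sum>z\<in>Y. y ^ (card R + 2 - card (f z))) = (\<Sum>(B, Q)\<in>Y. y ^ (2 - card Q))"
      by (rule sum.cong) (auto simp: Y_def card_f)
    also have "\<dots> = y ^ 2 + 2 * y" using \<open>p 0 \<noteq> p m\<close> by (simp add: Y_def)
    finally show ?thesis .
  qed
  moreover have "X \<inter> Y = {}" by (auto simp: X_def Y_def)
  ultimately show ?thesis
    unfolding \<Delta> using finXY sumX by (simp add: sum.reindex[OF inj_f] sum.union_disjoint add.assoc)
qed

section \<open>The lattice polytope\<close>

text \<open>If \<open>q \<le> 0\<close>, concavity together with a positive value at 0 leaves
  \<open>m\<close> as the only possible zero; \<open>slope\<close> excludes the value 0 there. If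
  \<open>q > 0\<close>, strict convexity would make \<open>g\<close> negative at an integer strictly
  between two zeros.\<close>

lemma quadratic_zeros_consecutive:
  fixes A B q :: real and m :: nat
  defines "g \<equiv> \<lambda>i :: nat. A + B * i + q * (real i)\<^sup>2"
  assumes nonneg: "\<And>i. i \<le> m \<Longrightarrow> 0 \<le> g i" and slope: "A = 0 \<Longrightarrow> B < 0" and m: "m > 0"
  obtains i where "i < m" "\<And>k. k \<le> m \<Longrightarrow> g k = 0 \<Longrightarrow> k = i \<or> k = Suc i"
proof (cases "q > 0")
  case False
  have "A \<noteq> 0"
  proof
    assume "A = 0"
    then have "B * real m < 0" "q * (real m)\<^sup>2 \<le> 0"
      using slope m False by (auto simp: mult_less_0_iff mult_nonpos_nonneg)
    with nonneg[of m] \<open>A = 0\<close> show False by (simp add: g_def)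
  qed
  then have A: "A > 0" using nonneg[of 0] by (simp add: g_def)
  have "k = m" if k: "k \<le> m" "g k = 0" for k
  proof (rule ccontr)
    assume "k \<noteq> m"
    then have km: "real k < real m" using k by simp
    \<comment> \<open>Linear interpolation between 0 and \<open>m\<close>, with its exact quadratic
      remainder.\<close>
    have "real m * g k = (real m - real k) * A + real k * g m + (- q) * (real m * real k * (real m - real k))"
      by (simp add: g_def algebra_simps power2_eq_square)
    moreover have "(real m - real k) * A > 0" "real k * g m \<ge> 0"
      using km A nonneg[of m] by auto
    moreover have "(- q) * (real m * real k * (real m - real k)) \<ge> 0"
      using km False by (intro mult_nonneg_nonneg) auto
    ultimately show False using k by simp
  qed
  then show thesis using that[of "m - 1"] m by force
next
  case True
  have near: "j = i \<or> j = Suc i" if ij: "i \<le> j" "j \<le> m" "g i = 0" "g j = 0" for i j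
  proof (rule ccontr)
    assume "\<not> (j = i \<or> j = Suc i)"
    then have "Suc i < j" using ij by simp
    then have lt: "real i + 1 < real j" by linarith
    \<comment> \<open>The same interpolation between the zeros \<open>i\<close> and
      \<open>j\<close>, evaluated at \<open>Suc i\<close>; the remainder now makes the value
      negative.\<close>
    have "(real j - real i) * g (Suc i) = (real j - real i - 1) * g i + g j
        - q * ((real j - real i) * (real j - real i - 1))"
      by (simp add: g_def algebra_simps power2_eq_square)
    moreover have "q * ((real j - real i) * (real j - real i - 1)) > 0"
      using lt True by (intro mult_pos_pos) auto
    moreover have "(real j - real i) * g (Suc i) \<ge> 0"
      using lt nonneg[of "Suc i"] \<open>Suc i < j\<close> ij by (intro mult_nonneg_nonneg) auto
    ultimately show False using ij by simp
  qed
  show thesis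
  proof (cases "\<exists>k\<le>m. g k = 0")
    case True
    define i where "i = (LEAST k. k \<le> m \<and> g k = 0)"
    have i: "i \<le> m" "g i = 0" using LeastI_ex[OF True[unfolded Bex_def]] by (auto simp: i_def)
    have least: "i \<le> k" if "k \<le> m" "g k = 0" for k
      using Least_le[of "\<lambda>k. k \<le> m \<and> g k = 0" k] that by (simp add: i_def)
    show thesis
    proof (cases "i = m")
      case True
      then show thesis using that[of "m - 1"] m least by force
    next
      case False
      then show thesis using that[of i] i least near by (metis le_neq_implies_less)
    qed
  next
    case False
    then show thesis using that[of 0] m by blast
  qed
qed

section \<open>Coordinates of the vertices and of affine functionals\<close>

locale stacked_construction =
  fixes u v :: "'n::finite" and m :: nat
  assumes uv: "u \<noteq> v" and m: "m > 0"
begin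

text \<open>The index \<open>u\<close>, whose coordinate is \<open>1 + N i\<close> on the curve,
  stands for the origin. The vertices of \<open>R\<close> are thus indexed by all coordinates except
  \<open>v\<close>, the one carrying \<open>i^2\<close>.\<close>

definition base :: "'n \<Rightarrow> real ^ 'n" where
  "base k = (if k = u then 0 else axis k 1)"

definition N :: nat where "N = card (UNIV - {v})"

definition curve :: "nat \<Rightarrow> real ^ 'n" where
  "curve i = (\<chi> k. if k = u then 1 + real N * real i else if k = v then (real i)\<^sup>2 else - real i)"

abbreviation "K \<equiv> UNIV - {v}"

text \<open>\<open>functional c A q\<close>, shifted by \<open>c u\<close>, is the affine functional with the values \<open>c k\<close> at the
  points \<open>base k\<close> and \<open>A\<close> at \<open>curve 0\<close>; the remaining freedom is the quadratic
  coefficient \<open>q\<close> of its restriction to the curve.\<close>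

definition functional :: "('n \<Rightarrow> real) \<Rightarrow> real \<Rightarrow> real \<Rightarrow> real ^ 'n" where
  "functional c A q = (\<chi> k. if k = u then A - c u else if k = v then q else c k - c u)"

lemma card_K: "card K = N"
  by (simp add: N_def)

lemma card_UNIV: "CARD('n) = Suc N"
  by (simp add: N_def card_Suc_Diff1)

lemma N_pos: "N > 0"
  using uv card_K by (metis DiffI UNIV_I card_gt_0_iff empty_iff finite singletonD)

lemma functional_base: "k \<noteq> v \<Longrightarrow> functional c A q \<bullet> base k + c u = c k"
  by (simp add: base_def functional_def inner_axis)

text \<open>The slope \<open>N\<close> in coordinate \<open>u\<close> is chosen so that
  \<open>c u\<close> enters the linear term with coefficient -1, just like every other
  \<open>c k\<close>. Hence the values on \<open>R\<close> matter only through their sum.\<close>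

lemma functional_curve:
  "functional c A q \<bullet> curve i + c u = A + (real N * A - sum c K) * i + q * (real i)\<^sup>2"
proof -
  define J where "J = UNIV - {u, v}"
  have K: "K = insert u J" "u \<notin> J" using uv by (auto simp: J_def)
  have cJ: "real (card J) = real N - 1" using K card_K by (metis card_insert_disjoint finite of_nat_Suc add_diff_cancel_left')
  have univ: "(UNIV :: 'n set) = insert u (insert v J)" "v \<notin> J" "u \<noteq> v" using uv by (auto simp: J_def)
  have "(\<Sum>k\<in>J. functional c A q $ k * curve i $ k) = (\<Sum>k\<in>J. (c k - c u) * - real i)"
    by (rule sum.cong) (auto simp: functional_def curve_def J_def)
  also have "\<dots> = - real i * (sum c J - (real N - 1) * c u)"
    by (simp add: sum_distrib_right[symmetric] sum_subtractf cJ sum_negf)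
  finally have J: "(\<Sum>k\<in>J. functional c A q $ k * curve i $ k) = - real i * (sum c J - (real N - 1) * c u)" .
  have "functional c A q \<bullet> curve i = (\<Sum>k\<in>UNIV. functional c A q $ k * curve i $ k)"
    by (simp add: inner_vec_def)
  also have "\<dots> = functional c A q $ u * curve i $ u + (functional c A q $ v * curve i $ v
      + (\<Sum>k\<in>J. functional c A q $ k * curve i $ k))"
    using univ(2,3) K(2) by (simp add: univ(1))
  also have "\<dots> = (A - c u) * (1 + real N * real i) + (q * (real i)\<^sup>2 - real i * (sum c J - (real N - 1) * c u))"
    unfolding J using uv by (simp add: functional_def curve_def)
  finally show ?thesis using K(2) by (simp add: K(1) algebra_simps)
qed

text \<open>The parametrization reaches every affine functional, so statements about all supporting
  hyperplanes reduce to statements about quadratics.\<close>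

lemma functional_surj:
  obtains c A q where "a = functional c A q" "\<gamma> = c u"
proof
  show "a = functional (\<lambda>k. if k = u then \<gamma> else a $ k + \<gamma>) (a $ u + \<gamma>) (a $ v)"
    by (simp add: functional_def vec_eq_iff)
qed simp

lemma base_lattice: "base k \<in> lattice_points"
  by (auto simp: base_def lattice_points_def axis_def)

lemma curve_lattice: "curve i \<in> lattice_points"
  by (auto simp: curve_def lattice_points_def)

lemma functional_lattice:
  "\<lbrakk>\<And>k. c k \<in> \<int>; A \<in> \<int>; q \<in> \<int>\<rbrakk> \<Longrightarrow> functional c A q \<in> lattice_points"
  by (auto simp: functional_def lattice_points_def)

lemma base_eq_iff: "base k = base l \<longleftrightarrow> k = l"
  by (auto simp: base_def axis_eq_axis)

lemma curve_eq_iff: "curve i = curve j \<longleftrightarrow> i = j"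
proof
  assume "curve i = curve j"
  then have "curve i $ v = curve j $ v" by simp
  then show "i = j" using uv by (simp add: curve_def)
qed simp

lemma base_neq_curve: "base k \<noteq> curve i"
proof
  assume "base k = curve i"
  then have "base k $ u = curve i $ u" by simp
  moreover have "base k $ u = 0" by (auto simp: base_def axis_def)
  moreover have "curve i $ u > 0" by (simp add: curve_def add_pos_nonneg)
  ultimately show False by simp
qed

lemmas vertex_neq = base_neq_curve base_neq_curve[symmetric]

section \<open>Vertex set, facet sets and their unimodularity\<close>

abbreviation "R \<equiv> base ` K"
abbreviation "V \<equiv> R \<union> curve ` {..m}"
abbreviation "\<F> \<equiv> stacked_facets R curve m"

lemma card_R: "card R = N"
  using card_K by (subst card_image) (auto simp: inj_on_def base_eq_iff)

text \<open>Reduces the search for an integral dual functional to choosing integers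
  \<open>c\<close>, \<open>A\<close> and \<open>q\<close> with the right values on \<open>R\<close>
  and a quadratic with the right values on the curve.\<close>

lemma functional_dual:
  assumes "\<And>k. c k \<in> \<int>" "A \<in> \<int>" "q \<in> \<int>" and S: "S \<subseteq> R \<union> range curve"
    and base: "\<And>k. k \<noteq> v \<Longrightarrow> base k \<in> S \<Longrightarrow> c k = (if base k = s then 1 else 0)"
    and curve: "\<And>i. curve i \<in> S \<Longrightarrow>
      A + (real N * A - sum c K) * i + q * (real i)\<^sup>2 = (if curve i = s then 1 else 0)"
  shows "\<exists>a \<beta>. a \<in> lattice_points \<and> \<beta> \<in> \<int> \<and> (\<forall>t\<in>S. a \<bullet> t + \<beta> = (if t = s then 1 else 0))"
proof (intro exI conjI ballI)
  show "functional c A q \<in> lattice_points" using assms(1-3) by (rule functional_lattice)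
  show "c u \<in> \<int>" by fact
  fix t assume t: "t \<in> S"
  with S consider k where "k \<noteq> v" "t = base k" | i where "t = curve i" by blast
  then show "functional c A q \<bullet> t + c u = (if t = s then 1 else 0)"
  proof cases
    case 1
    then show ?thesis using base[of k] t functional_base[of k c A q] by simp
  next
    case 2
    then show ?thesis using curve[of i] t functional_curve[of c A q i] by simp
  qed
qed

text \<open>\<open>1 + N j\<close> and \<open>j^2\<close> are coprime:
  \<open>(1 - N j) (1 + N j) + N^2 j^2 = 1\<close>. These Bezout coefficients are \<open>A\<close>
  and \<open>q\<close> for the apex; for a vertex of \<open>R\<close> they are multiplied by
  \<open>j\<close> to cancel the term \<open>- j\<close> coming from
  \<open>sum c K = 1\<close>.\<close>

lemma unimodular_cone: "unimodular (insert (curve j) R)"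
  unfolding unimodular_def
proof (intro conjI ballI)
  show "insert (curve j) R \<subseteq> lattice_points" using base_lattice curve_lattice by auto
next
  fix s assume s: "s \<in> insert (curve j) R"
  show "\<exists>a \<beta>. a \<in> lattice_points \<and> \<beta> \<in> \<int> \<and>
      (\<forall>t\<in>insert (curve j) R. a \<bullet> t + \<beta> = (if t = s then 1 else 0))"
  proof (cases "s = curve j")
    case True
    show ?thesis
      by (rule functional_dual[where c = "\<lambda>_. 0" and A = "1 - real N * j" and q = "(real N)\<^sup>2"])
         (auto simp: True vertex_neq curve_eq_iff algebra_simps power2_eq_square)
  next
    case False
    then obtain l where l: "s = base l" "l \<noteq> v" using s by auto
    define c where "c = (\<lambda>k. if k = l then 1 else 0 :: real)"
    have C: "sum c K = 1" using l by (simp add: c_def)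
    show ?thesis
      by (rule functional_dual[where c = c and A = "real j * (1 - real N * j)" and q = "j * (real N)\<^sup>2"], unfold C)
         (auto simp: c_def l(1) vertex_neq base_eq_iff curve_eq_iff algebra_simps power2_eq_square)
  qed
qed simp

text \<open>The vertex \<open>base b\<close> is missing, so the value \<open>c b\<close> is free and
  adjusts \<open>sum c K\<close> at will. With \<open>q = 0\<close> it produces the linear functions
  \<open>i + 1 - k\<close> and \<open>k - i\<close> of the curve parameter \<open>k\<close>, or the
  zero function when \<open>s\<close> is a vertex of \<open>R\<close>.\<close>

lemma unimodular_wall:
  assumes b: "b \<noteq> v"
  shows "unimodular ((R - {base b}) \<union> {curve i, curve (Suc i)})" (is "unimodular ?S")
  unfolding unimodular_def
proof (intro conjI ballI)
  show "?S \<subseteq> lattice_points" using base_lattice curve_lattice by auto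
next
  fix s assume s: "s \<in> ?S"
  then consider "s = curve i" | "s = curve (Suc i)" | l where "s = base l" "l \<noteq> v" "l \<noteq> b"
    by auto
  then show "\<exists>a \<beta>. a \<in> lattice_points \<and> \<beta> \<in> \<int> \<and> (\<forall>t\<in>?S. a \<bullet> t + \<beta> = (if t = s then 1 else 0))"
  proof cases
    case 1
    define c where "c = (\<lambda>k. if k = b then 1 + real N * (real i + 1) else 0)"
    have C: "sum c K = 1 + real N * (real i + 1)" using b by (simp add: c_def)
    show ?thesis
      by (rule functional_dual[where c = c and A = "real i + 1" and q = 0], unfold C)
         (auto simp: c_def 1 vertex_neq base_eq_iff curve_eq_iff algebra_simps)
  next
    case 2
    define c where "c = (\<lambda>k. if k = b then - 1 - real N * real i else 0)"
    have C: "sum c K = - 1 - real N * real i" using b by (simp add: c_def)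
    show ?thesis
      by (rule functional_dual[where c = c and A = "- real i" and q = 0], unfold C)
         (auto simp: c_def 2 vertex_neq base_eq_iff curve_eq_iff algebra_simps)
  next
    case 3
    define c where "c = (\<lambda>k. (if k = l then 1 else 0) - (if k = b then 1 else 0 :: real))"
    have C: "sum c K = 0" using b 3 by (simp add: c_def sum_subtractf)
    show ?thesis
      by (rule functional_dual[where c = c and A = 0 and q = 0], unfold C)
         (auto simp: c_def 3 vertex_neq base_eq_iff)
  qed
qed simp

lemma facetE:
  assumes "F \<in> \<F>"
  obtains (first) "F = insert (curve 0) R"
    | (last) "F = insert (curve m) R"
    | (wall) b i where "b \<noteq> v" "i < m" "F = (R - {base b}) \<union> {curve i, curve (Suc i)}"
  using assms unfolding stacked_facets_def by blast

lemma first_facet: "insert (curve 0) R \<in> \<F>"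
  and last_facet: "insert (curve m) R \<in> \<F>"
  and wall_facet: "b \<noteq> v \<Longrightarrow> i < m \<Longrightarrow> (R - {base b}) \<union> {curve i, curve (Suc i)} \<in> \<F>"
  unfolding stacked_facets_def by (simp, simp, blast)

lemma unimodular_facet: "F \<in> \<F> \<Longrightarrow> unimodular F"
  by (erule facetE) (blast intro: unimodular_cone unimodular_wall)+

lemma card_facet: "F \<in> \<F> \<Longrightarrow> card F = CARD('n)"
proof (erule facetE)
  have cone: "card (insert (curve i) R) = CARD('n)" for i
    using vertex_neq by (subst card_insert_disjoint) (auto simp: card_R card_UNIV)
  show "card F = CARD('n)" if "F = insert (curve 0) R" using that cone by simp
  show "card F = CARD('n)" if "F = insert (curve m) R" using that cone by simp
  show "card F = CARD('n)" if "b \<noteq> v" "F = (R - {base b}) \<union> {curve i, curve (Suc i)}" for b i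
  proof -
    have "card F = card (R - {base b}) + card {curve i, curve (Suc i)}"
      unfolding that(2) using vertex_neq by (intro card_Un_disjoint) auto
    also have "\<dots> = CARD('n)"
      using that(1) N_pos by (simp add: card_Diff_singleton card_R card_UNIV curve_eq_iff)
    finally show ?thesis .
  qed
qed

section \<open>Supporting hyperplanes\<close>

lemma facet_proper: "F \<in> \<F> \<Longrightarrow> F \<noteq> V"
proof (erule facetE)
  assume "F = insert (curve 0) R"
  then have "curve m \<notin> F" using m vertex_neq by (auto simp: curve_eq_iff)
  then show ?thesis by auto
next
  assume "F = insert (curve m) R"
  then have "curve 0 \<notin> F" using m vertex_neq by (auto simp: curve_eq_iff)
  then show ?thesis by auto
next
  fix b i assume "b \<noteq> v" "F = (R - {base b}) \<union> {curve i, curve (Suc i)}"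
  then have "base b \<notin> F" "base b \<in> V" using vertex_neq by auto
  then show ?thesis by auto
qed

text \<open>The counterpart of \<open>functional_dual\<close> for supporting hyperplanes:
  nonnegativity and the zero set are read off from \<open>c\<close> and from the quadratic.\<close>

lemma functional_supports:
  assumes "\<And>k. k \<noteq> v \<Longrightarrow> 0 \<le> c k" "\<And>i. i \<le> m \<Longrightarrow> 0 \<le> A + (real N * A - sum c K) * i + q * (real i)\<^sup>2"
    and "F = base ` {k. k \<noteq> v \<and> c k = 0} \<union>
      curve ` {i. i \<le> m \<and> A + (real N * A - sum c K) * i + q * (real i)\<^sup>2 = 0}"
  shows "\<exists>a \<gamma>. (\<forall>x\<in>V. 0 \<le> a \<bullet> x + \<gamma>) \<and> F = {x \<in> V. a \<bullet> x + \<gamma> = 0}"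
proof (intro exI conjI)
  have base: "functional c A q \<bullet> base k + c u = c k" if "k \<in> K" for k
    using that by (simp add: functional_base)
  show "\<forall>x\<in>V. 0 \<le> functional c A q \<bullet> x + c u"
  proof
    fix x assume "x \<in> V"
    then consider k where "k \<noteq> v" "x = base k" | i where "i \<le> m" "x = curve i" by blast
    then show "0 \<le> functional c A q \<bullet> x + c u"
      using assms(1,2) base by cases (simp_all add: functional_curve)
  qed
  have "{x \<in> V. functional c A q \<bullet> x + c u = 0} = base ` {k \<in> K. functional c A q \<bullet> base k + c u = 0} \<union>
      curve ` {i \<in> {..m}. functional c A q \<bullet> curve i + c u = 0}"
    by blast
  also have "\<dots> = F"
    unfolding assms(3) functional_curve by (simp add: base cong: conj_cong)
  finally show "F = {x \<in> V. functional c A q \<bullet> x + c u = 0}" ..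
qed

text \<open>The quadratics are \<open>i^2\<close> for the first cone,
  \<open>(m - i) (m + i + N m i)\<close> for the last and \<open>(k - i) (k - (i + 1))\<close> for a
  wall; \<open>A\<close> and \<open>q\<close> come from expanding them. For the cones
  \<open>c = 0\<close> forces the slope \<open>N A\<close>, which explains the second factor in the
  middle one.\<close>

lemma facet_supported:
  assumes "F \<in> \<F>"
  shows "\<exists>a \<gamma>. (\<forall>x\<in>V. 0 \<le> a \<bullet> x + \<gamma>) \<and> F = {x \<in> V. a \<bullet> x + \<gamma> = 0}"
  using assms
proof (cases rule: facetE)
  case first
  then show ?thesis
    by (intro functional_supports[where c = "\<lambda>_. 0" and A = 0 and q = 1]) auto
next
  case last
  have eq: "(real m)\<^sup>2 + real N * (real m)\<^sup>2 * real i + - (1 + real N * m) * (real i)\<^sup>2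
      = (real m - real i) * (real m + real i + real N * m * i)" for i
    by (simp add: algebra_simps power2_eq_square)
  have "0 < real m + real i + real N * m * i" for i
    using m by (intro add_pos_nonneg) auto
  then have zero: "(real m - real i) * (real m + real i + real N * m * i) = 0 \<longleftrightarrow> i = m" for i
    by (metis less_irrefl mult_eq_0_iff of_nat_eq_iff right_minus_eq)
  show ?thesis
  proof (rule functional_supports[where c = "\<lambda>_. 0" and A = "(real m)\<^sup>2" and q = "- (1 + real N * m)"])
    show "0 \<le> (real m)\<^sup>2 + (real N * (real m)\<^sup>2 - (\<Sum>k\<in>K. 0)) * i + - (1 + real N * m) * (real i)\<^sup>2"
      if "i \<le> m" for i
      using that by (simp only: eq sum.neutral_const diff_zero) simp
    show "F = base ` {k. k \<noteq> v \<and> 0 = (0 :: real)} \<union>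
        curve ` {i. i \<le> m \<and> (real m)\<^sup>2 + (real N * (real m)\<^sup>2 - (\<Sum>k\<in>K. 0)) * i + - (1 + real N * m) * (real i)\<^sup>2 = 0}"
      unfolding last by (simp only: eq sum.neutral_const diff_zero zero) auto
  qed simp
next
  case (wall b i)
  \<comment> \<open>\<open>D\<close> solves \<open>N A - D = - (2 i + 1)\<close> for
    \<open>A = i (i + 1)\<close>, which gives the quadratic the linear coefficient of
    \<open>(k - i) (k - (i + 1))\<close>. The whole sum is placed on the missing vertex
    \<open>b\<close>.\<close>
  define D where "D = real N * (real i * (real i + 1)) + (2 * real i + 1)"
  define c where "c = (\<lambda>k. if k = b then D else 0)"
  have C: "sum c K = D" using wall(1) by (simp add: c_def)
  have D: "D > 0" unfolding D_def by (intro add_nonneg_pos) auto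
  have eq: "real i * (real i + 1) + (real N * (real i * (real i + 1)) - sum c K) * k + 1 * (real k)\<^sup>2
      = (real k - real i) * (real k - real (Suc i))" for k
    unfolding C by (simp add: D_def algebra_simps power2_eq_square)
  show ?thesis
  proof (rule functional_supports[where c = c and A = "real i * (real i + 1)" and q = 1])
    show "0 \<le> real i * (real i + 1) + (real N * (real i * (real i + 1)) - sum c K) * k + 1 * (real k)\<^sup>2" for k :: nat
      unfolding eq by (cases "k \<le> i") (auto intro!: mult_nonpos_nonpos)
    show "F = base ` {k. k \<noteq> v \<and> c k = 0} \<union>
        curve ` {k. k \<le> m \<and> real i * (real i + 1) + (real N * (real i * (real i + 1)) - sum c K) * k + 1 * (real k)\<^sup>2 = 0}"
    proof -
      have "(real k - real i) * (real k - real (Suc i)) = 0 \<longleftrightarrow> k = i \<or> k = Suc i" for k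
        by (simp only: mult_eq_0_iff right_minus_eq of_nat_eq_iff)
      then have "curve ` {k. k \<le> m \<and> (real k - real i) * (real k - real (Suc i)) = 0} = {curve i, curve (Suc i)}"
        using wall(2) by auto
      moreover have "base ` {k. k \<noteq> v \<and> c k = 0} = R - {base b}"
        using D by (auto simp: c_def base_eq_iff)
      ultimately show ?thesis unfolding eq wall(3) by simp
    qed
  qed (use D in \<open>simp add: c_def\<close>)
qed

text \<open>If the functional is positive at some \<open>base b\<close>, then
  \<open>sum c K > 0\<close>, the zeros on the curve are among two consecutive points, and the wall
  at \<open>b\<close> contains the zero set. Otherwise it vanishes on \<open>R\<close>, and its
  zeros on the curve are at most the first point (\<open>A = 0\<close>) or at most the last one
  (\<open>A > 0\<close>).\<close>

lemma support_in_facet: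
  assumes nonneg: "\<forall>x\<in>V. 0 \<le> a \<bullet> x + \<gamma>" and ne: "{x \<in> V. a \<bullet> x + \<gamma> = 0} \<noteq> V"
  shows "\<exists>F\<in>\<F>. {x \<in> V. a \<bullet> x + \<gamma> = 0} \<subseteq> F"
proof -
  obtain c A q where a: "a = functional c A q" "\<gamma> = c u" by (rule functional_surj)
  define g where "g = (\<lambda>i :: nat. A + (real N * A - sum c K) * i + q * (real i)\<^sup>2)"
  have base: "a \<bullet> base k + \<gamma> = c k" if "k \<noteq> v" for k using that by (simp add: a functional_base)
  have curve: "a \<bullet> curve i + \<gamma> = g i" for i by (simp add: a functional_curve g_def)
  have c: "0 \<le> c k" if "k \<noteq> v" for k using bspec[OF nonneg, of "base k"] base[OF that] that by simp
  have g: "0 \<le> g i" if "i \<le> m" for i using bspec[OF nonneg, of "curve i"] curve[of i] that by simp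
  show ?thesis
  proof (cases "\<exists>b. b \<noteq> v \<and> c b \<noteq> 0")
    case True
    then obtain b where b: "b \<noteq> v" "c b \<noteq> 0" by blast
    have C: "0 < sum c K"
    proof (rule sum_pos2[of K b])
      show "0 < c b" using b c[of b] by simp
    qed (use b c in auto)
    have "\<exists>i<m. \<forall>k\<le>m. g k = 0 \<longrightarrow> k = i \<or> k = Suc i"
    proof (rule quadratic_zeros_consecutive[of m A "real N * A - sum c K" q])
      show "0 \<le> A + (real N * A - sum c K) * real i + q * (real i)\<^sup>2" if "i \<le> m" for i
        using g[OF that] by (simp add: g_def)
      show "real N * A - sum c K < 0" if "A = 0" using that C by simp
      show ?thesis if "i < m" "\<And>k. k \<le> m \<Longrightarrow>
          A + (real N * A - sum c K) * real k + q * (real k)\<^sup>2 = 0 \<Longrightarrow> k = i \<or> k = Suc i" for i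
        using that by (intro exI[of _ i] conjI allI impI) (simp_all add: g_def)
    qed (rule m)
    then obtain i where i: "i < m" "\<And>k. k \<le> m \<Longrightarrow> g k = 0 \<Longrightarrow> k = i \<or> k = Suc i"
      by blast
    then have "{x \<in> V. a \<bullet> x + \<gamma> = 0} \<subseteq> (R - {base b}) \<union> {curve i, curve (Suc i)}"
    proof (intro subsetI)
      fix x assume "x \<in> {x \<in> V. a \<bullet> x + \<gamma> = 0}"
      then have "x \<in> V" and zero: "a \<bullet> x + \<gamma> = 0" by blast+
      from \<open>x \<in> V\<close> consider k where "k \<noteq> v" "x = base k" | k where "k \<le> m" "x = curve k" by blast
      then show "x \<in> (R - {base b}) \<union> {curve i, curve (Suc i)}"
      proof cases
        case 1
        with zero base have "c k = 0" by simp
        with 1 b(2) show ?thesis by (auto simp: base_eq_iff)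
      next
        case 2
        with zero curve have "g k = 0" by simp
        with 2 i(2) show ?thesis by blast
      qed
    qed
    then show ?thesis using wall_facet[OF b(1) i(1)] by (rule bexI)
  next
    case False
    then have C: "sum c K = 0" by (intro sum.neutral) auto
    have "A \<ge> 0" using g[of 0] by (simp add: g_def)
    then consider "A = 0" | "A > 0" by force
    then show ?thesis
    proof cases
      case 1
      then have gq: "g i = q * (real i)\<^sup>2" for i by (simp add: g_def C)
      have "q \<noteq> 0"
      proof
        assume "q = 0"
        then have "a \<bullet> x + \<gamma> = 0" if "x \<in> V" for x
          using that False base curve gq by (elim UnE imageE) auto
        then have "{x \<in> V. a \<bullet> x + \<gamma> = 0} = V" by blast
        with ne show False ..
      qed
      then have "{x \<in> V. a \<bullet> x + \<gamma> = 0} \<subseteq> insert (curve 0) R" by (auto simp: curve gq)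
      then show ?thesis using first_facet by (rule bexI)
    next
      case 2
      have "i = m" if i: "i \<le> m" "g i = 0" for i
      proof (rule ccontr)
        assume "i \<noteq> m"
        then have im: "real i < real m" using i by simp
        \<comment> \<open>Eliminates \<open>q\<close> between the values at \<open>i\<close> and at
          \<open>m\<close>; what remains is \<open>A\<close> times the quadratic that supports the
          last cone.\<close>
        have "g m * (real i)\<^sup>2 = (real m)\<^sup>2 * g i - A * ((real m - real i) * (real m + real i + real N * m * i))"
          by (simp add: g_def C algebra_simps power2_eq_square)
        moreover have "A * ((real m - real i) * (real m + real i + real N * m * i)) > 0"
          using im 2 m by (intro mult_pos_pos add_pos_nonneg) auto
        moreover have "g m * (real i)\<^sup>2 \<ge> 0" using g[of m] by simp
        ultimately show False using i by simp
      qed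
      then have "{x \<in> V. a \<bullet> x + \<gamma> = 0} \<subseteq> insert (curve m) R" by (auto simp: curve curve_eq_iff)
      then show ?thesis using last_facet by (rule bexI)
    qed
  qed
qed

section \<open>The polytope, its facets and its h-vector\<close>

definition P :: "(real ^ 'n) set" where "P = convex hull V"

definition \<Delta> :: "(real ^ 'n) set set" where "\<Delta> = {S. \<exists>F\<in>\<F>. S \<subseteq> F}"

lemma boundary_complex_P: "boundary_complex P = (hull) convex ` \<Delta>"
  unfolding P_def \<Delta>_def
proof (rule boundary_complex_convex_hull)
  show "\<not> affine_dependent F" if "F \<in> \<F>" for F
    using that by (intro unimodular_imp_affine_independent unimodular_facet)
  show "F \<noteq> V" if "F \<in> \<F>" for F using that by (rule facet_proper)
  show "\<exists>a \<gamma>. (\<forall>x\<in>V. 0 \<le> a \<bullet> x + \<gamma>) \<and> F = {x \<in> V. a \<bullet> x + \<gamma> = 0}" if "F \<in> \<F>" for F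
    using that by (rule facet_supported)
  show "\<exists>F\<in>\<F>. {x \<in> V. a \<bullet> x + \<gamma> = 0} \<subseteq> F"
    if "\<forall>x\<in>V. 0 \<le> a \<bullet> x + \<gamma>" "{x \<in> V. a \<bullet> x + \<gamma> = 0} \<noteq> V" for a \<gamma>
    using that by (rule support_in_facet)
qed simp

lemma finite_\<Delta>: "finite \<Delta>"
proof -
  have "finite V" by simp
  moreover have "F \<subseteq> V" if "F \<in> \<F>" for F
    using facet_supported[OF that] by (elim exE conjE) (simp only: Collect_restrict)
  then have "\<Delta> \<subseteq> Pow V" unfolding \<Delta>_def by fast
  ultimately show ?thesis by (meson finite_Pow_iff finite_subset)
qed

lemma \<Delta>_independent: "S \<in> \<Delta> \<Longrightarrow> \<not> affine_dependent S"
  using affine_independent_subset[OF unimodular_imp_affine_independent[OF unimodular_facet]]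
  by (auto simp: \<Delta>_def)

text \<open>An affine functional vanishing on \<open>V\<close> is trivial: the points of
  \<open>R\<close> force \<open>c\<close> to vanish on \<open>K\<close>, \<open>curve 0\<close>
  forces \<open>A = 0\<close>, and then \<open>curve m\<close> forces \<open>q = 0\<close>.\<close>

lemma aff_dim_P: "aff_dim P = int CARD('n)"
proof (rule ccontr)
  assume "aff_dim P \<noteq> int CARD('n)"
  then have "aff_dim P < DIM(real ^ 'n)" using aff_dim_le_DIM[of P] by simp
  then obtain a b where "a \<noteq> 0" "P \<subseteq> {x. a \<bullet> x = b}"
    using aff_lowdim_subset_hyperplane by blast
  then have V: "a \<bullet> x + (- b) = 0" if "x \<in> V" for x
    using that hull_inc[of x V convex] by (auto simp: P_def)
  obtain c A q where a: "a = functional c A q" "- b = c u" by (rule functional_surj)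
  have c: "c k = 0" if "k \<noteq> v" for k
    using V[of "base k"] that by (simp add: a functional_base)
  then have C: "sum c K = 0" by (intro sum.neutral) auto
  have curve: "A + real N * A * real i + q * (real i)\<^sup>2 = 0" if "i \<le> m" for i
    using V[of "curve i"] that functional_curve[of c A q i] C by (simp add: a)
  have "A = 0" using curve[of 0] by simp
  moreover have "q = 0" using curve[of m] \<open>A = 0\<close> m by simp
  ultimately have "a = 0" using c c[OF uv] by (auto simp: a functional_def vec_eq_iff)
  with \<open>a \<noteq> 0\<close> show False by blast
qed

text \<open>A facet is spanned by a member of \<open>\<Delta>\<close> with as many elements as a
  listed facet set, hence by the listed set itself.\<close>

lemma facet_of_P:
  assumes "F facet_of P"
  obtains S where "unimodular S" "S \<noteq> {}" "F = convex hull S"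
proof -
  from assms have F: "F face_of P" "aff_dim F = int CARD('n) - 1"
    by (auto simp: facet_of_def aff_dim_P)
  then have "F \<in> boundary_complex P" using aff_dim_P by (auto simp: boundary_complex_def)
  then obtain S G where S: "F = convex hull S" "S \<in> \<Delta>" and G: "S \<subseteq> G" "G \<in> \<F>"
    unfolding boundary_complex_P by (auto simp: \<Delta>_def)
  have "card S = CARD('n)"
    using F(2) aff_dim_affine_independent[OF \<Delta>_independent[OF S(2)]] by (simp add: S(1) aff_dim_convex_hull)
  then have "S = G"
    using G card_facet[OF G(2)] unimodular_facet[OF G(2)]
    by (intro card_subset_eq) (auto simp: unimodular_def)
  moreover have "S \<noteq> {}" using \<open>card S = CARD('n)\<close> by auto
  ultimately show thesis using unimodular_facet[OF G(2)] by (intro that[OF _ _ S(1)]) simp_all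
qed

lemma integral_P: "integral_polytope P"
  unfolding integral_polytope_def
proof
  show "polytope P" by (simp add: P_def polytope_convex_hull)
  have "{x. x extreme_point_of P} \<subseteq> V" unfolding P_def by (rule extreme_points_of_convex_hull)
  also have "V \<subseteq> lattice_points" using base_lattice curve_lattice by auto
  finally show "{x. x extreme_point_of P} \<subseteq> lattice_points" .
qed

lemma simplicial_P: "simplicial_polytope P"
proof -
  have "polytope P" by (simp add: P_def polytope_convex_hull)
  moreover have "\<exists>k. k simplex F" if "F facet_of P" for F
    using that
  proof (rule facet_of_P)
    fix S assume "unimodular S" "F = convex hull S"
    then have "(int (card S) - 1) simplex F"
      using unimodular_imp_affine_independent by (auto simp: simplex_def)
    then show ?thesis ..
  qed
  ultimately show ?thesis by (simp add: simplicial_polytope_def)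
qed

lemma facet_volume_P: "F facet_of P \<Longrightarrow> has_normalized_volume F 1"
  by (erule facet_of_P) (simp add: unimodular_normalized_volume)

text \<open>Both sides are multiplied by \<open>y = x - 1\<close>: this telescopes the geometric sum
  in the h-polynomial and supplies the extra power in \<open>stacked_faces_sum\<close>. Afterwards
  the nonzero factor \<open>y\<close> is cancelled.\<close>

lemma h_vector_P: "is_h_vector P (1 # replicate (CARD('n) - 1) (int m) @ [1])"
proof -
  define h where "h = 1 # replicate N (int m) @ [1]"
  define x :: "int poly" where "x = [:0, 1:]"
  define y :: "int poly" where "y = [:-1, 1:]"
  have x: "x = 1 + y" by (simp add: x_def y_def one_pCons)
  have mon: "monom a i = of_int a * x ^ i" for a i
    by (simp add: x_def monom_altdef of_int_poly)
  define f where "f = (\<Sum>S\<in>\<Delta>. y ^ (Suc N - card S))"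
  have card\<Delta>: "card S \<le> Suc N" if "S \<in> \<Delta>" for S
  proof -
    obtain F where F: "F \<in> \<F>" "S \<subseteq> F" using \<open>S \<in> \<Delta>\<close> by (auto simp: \<Delta>_def)
    then have "finite F" using unimodular_facet[OF F(1)] by (simp add: unimodular_def)
    with card_mono[OF _ F(2)] card_facet[OF F(1)] show ?thesis by (simp add: card_UNIV)
  qed
  have "(\<Sum>i\<le>Suc N. smult (int (num_faces (boundary_complex P) (int i - 1))) (y ^ (Suc N - i))) = f"
    unfolding boundary_complex_P f_def
    by (intro sum_num_faces finite_\<Delta> \<Delta>_independent card\<Delta>)
  moreover have "(\<Sum>i\<le>Suc N. monom (h ! i) (Suc N - i)) = f"
  proof -
    have "(\<Sum>i\<le>Suc N. monom (h ! i) (Suc N - i)) = x ^ Suc N + (\<Sum>i\<le>N. of_int (h ! Suc i) * x ^ (N - i))"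
      by (subst sum.atMost_Suc_shift) (simp add: mon h_def)
    also have "(\<Sum>i\<le>N. of_int (h ! Suc i) * x ^ (N - i)) = (\<Sum>i<N. of_int (h ! Suc i) * x ^ (N - i)) + 1"
      by (simp add: lessThan_Suc_atMost[symmetric] h_def nth_append)
    also have "(\<Sum>i<N. of_int (h ! Suc i) * x ^ (N - i)) = (\<Sum>i<N. of_nat m * x * x ^ (N - Suc i))"
      by (intro sum.cong) (auto simp: h_def nth_append Suc_diff_Suc simp flip: power_Suc)
    also have "\<dots> = of_nat m * x * (\<Sum>i<N. x ^ i)"
      by (simp add: sum_distrib_left[symmetric] sum.nat_diff_reindex)
    finally have "y * (\<Sum>i\<le>Suc N. monom (h ! i) (Suc N - i))
        = y * (x ^ Suc N + 1) + of_nat m * x * (y * (\<Sum>i<N. x ^ i))"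
      by (simp add: algebra_simps)
    also have "y * (\<Sum>i<N. x ^ i) = x ^ N - 1"
      using power_diff_1_eq[of x N] by (simp add: x)
    \<comment> \<open>Uses \<open>y^2 + 2 y = x^2 - 1\<close>, the contribution of the faces
      containing \<open>R\<close>.\<close>
    also have "y * (x ^ Suc N + 1) + of_nat m * x * (x ^ N - 1)
        = ((1 + y) ^ N - 1) * ((1 + y) * (y + of_nat m)) + y ^ 2 + 2 * y"
      by (simp add: x algebra_simps power2_eq_square)
    also have "\<dots> = (\<Sum>S\<in>\<Delta>. y ^ (N + 2 - card S))"
      unfolding \<Delta>_def card_R[symmetric]
    proof (rule stacked_faces_sum[symmetric])
      show "R \<noteq> {}" using uv by auto
      show "inj_on curve {..m}" by (auto simp: inj_on_def curve_eq_iff)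
      show "curve ` {..m} \<inter> R = {}" using vertex_neq by auto
    qed (use m in auto)
    \<comment> \<open>Faces have at most \<open>Suc N\<close> vertices, so the truncated subtraction
      leaves a factor \<open>y\<close> to split off from every term.\<close>
    also have "\<dots> = y * f"
      unfolding f_def sum_distrib_left using card\<Delta>
      by (intro sum.cong) (auto simp: Suc_diff_le simp flip: power_Suc)
    finally have eq: "y * (\<Sum>i\<le>Suc N. monom (h ! i) (Suc N - i)) = y * f" .
    have "y \<noteq> 0" by (simp add: y_def)
    from iffD1[OF mult_left_cancel[OF this] eq] show ?thesis .
  qed
  ultimately show ?thesis
    unfolding is_h_vector_def Let_def aff_dim_P card_UNIV nat_int h_def y_def diff_Suc_1 by simp
qed

end

theorem theorem2p4:
  fixes d :: nat and h\<^sub>1 :: int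
  assumes "CARD('n::finite) = d" and "d \<ge> 2" and "h\<^sub>1 > 0"
  shows "\<exists>P :: (real ^ 'n) set.
    integral_polytope P \<and> simplicial_polytope P \<and> aff_dim P = int d \<and>
    (\<forall>F. F facet_of P \<longrightarrow> has_normalized_volume F 1) \<and>
    is_h_vector P (1 # replicate (d - 1) h\<^sub>1 @ [1])"
proof -
  have "\<exists>u v :: 'n. u \<noteq> v"
  proof (rule ccontr)
    assume "\<nexists>u v :: 'n. u \<noteq> v"
    then have "(UNIV :: 'n set) = {undefined}" by auto
    then have "CARD('n) = card {undefined :: 'n}" by (rule arg_cong)
    with assms(1,2) show False by simp
  qed
  then obtain u v :: 'n where "u \<noteq> v" by blast
  \<comment> \<open>The prescribed \<open>h\<^sub>1\<close> becomes the number of edges of the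
    path.\<close>
  then interpret stacked_construction u v "nat h\<^sub>1"
    using assms by unfold_locales auto
  show ?thesis
    using integral_P simplicial_P aff_dim_P facet_volume_P h_vector_P assms by auto
qed

end
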